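(* Let $a_t\geqslant 0$ and $P_t=\begin{pmatrix}p^{(11)}_t&p^{(12)}_t\\ p^{(12)}_t&p^{(22)}_t\end{pmatrix}\succcurlyeq 0$ be continuously differentiable functions of time $t>0$. For $f\in\mathcal{F}_{0,\infty}$ on $\mathbf{R}^d$ with a minimizer $x_\star$, $f_\star=f(x_\star)$, and a trajectory $X_t$, put $$\mathcal{V}_{a_t,P_t}(X_t,t)=a_t\,(f(X_t)-f_\star)+\begin{pmatrix}X_t-x_\star\\ \dot X_t\end{pmatrix}^{\top}(P_t\otimes I_d)\begin{pmatrix}X_t-x_\star\\ \dot X_t\end{pmatrix}.$$ The following assertions are equivalent: (i) The inequality $\frac{d}{dt}\mathcal{V}_{a_t,P_t}(X_t,t)\leqslant 0$ is satisfied (for all $t>0$) for every dimension $d\in\mathbf{N}$, every function $f\in\mathcal{F}_{0,\infty}$ on $\mathbf{R}^d$ having a minimizer $x_\star$, and every trajectory $X_t$ generated by the accelerated gradient flow $\ddot X_t+\frac3t\dot X_t+\nabla f(X_t)=0$. (ii) For all $t>0$ there exist $\lambda^{(1)}_t,\lambda^{(2)}_t\geqslant 0$ such that $$\begin{pmatrix}\dot p^{(11)}_t & p^{(11)}_t-\frac3t p^{(12)}_t+\dot p^{(12)}_t & -p^{(12)}_t+\frac{\lambda^{(1)}_t}{2}\\ p^{(11)}_t-\frac3t p^{(12)}_t+\dot p^{(12)}_t & 2\left(p^{(12)}_t-\frac3t p^{(22)}_t\right)+\dot p^{(22)}_t & -p^{(22)}_t+\frac{a_t}{2}\\ -p^{(12)}_t+\frac{\lambda^{(1)}_t}{2}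 & -p^{(22)}_t+\frac{a_t}{2} & 0\end{pmatrix}\preccurlyeq 0,\qquad \dot a_t=\lambda^{(1)}_t-\lambda^{(2)}_t .$$
   Context: $\mathcal{F}_{0,\infty}$ denotes the family of differentiable convex functions $f:\mathbf{R}^d\to\mathbf{R}$; functions are assumed to have a minimizer $x_\star$. Trajectories are solutions of the ODE on $t>0$ (where the coefficient $3/t$ is defined), with arbitrary position and velocity at a given positive time. A dot denotes the derivative with respect to $t$. $M\preccurlyeq 0$ (resp. $M\succcurlyeq 0$) means that the symmetric matrix $M$ is negative (resp. positive) semidefinite; $\otimes$ is the Kronecker product. *)

theory Defs
  imports "HOL-Analysis.Analysis"
begin

text \<open>
  The decrease of the Lyapunov function in every dimension $d$ is one side of an equivalence, so $d$ cannot be the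
  cardinality of an index type.  All the spaces $\mathbf{R}^d$ are therefore realised inside one
  inner product space, the finitely supported real sequences with the standard dot product:
  \<open>Rd d\<close> consists of the vectors whose coordinates with index $\geq d$ vanish, so that its
  elements are determined by the coordinates $0, \dots, d-1$.  Functions on $\mathbf{R}^d$ are
  total functions of which only the values on \<open>Rd d\<close> are used, and their derivatives are
  derivatives within \<open>Rd d\<close>.
\<close>

typedef fvec = "{x :: nat \<Rightarrow> real. finite {i. x i \<noteq> 0}}"
  morphisms coord fvec_of
  by (intro exI[of _ "\<lambda>i. 0"]) simp

setup_lifting type_definition_fvec

lemma finite_coord [simp]: "finite {i. coord x i \<noteq> 0}"
  using coord[of x] by simp

lemma fvec_eqI: "(\<And>i. coord x i = coord y i) \<Longrightarrow> x = y"
  by (metis coord_inject ext)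

instantiation fvec :: real_vector
begin

lift_definition zero_fvec :: fvec is "\<lambda>i. 0" by simp

lift_definition plus_fvec :: "fvec \<Rightarrow> fvec \<Rightarrow> fvec" is "\<lambda>x y i. x i + y i"
  subgoal for x y by (rule finite_subset[of _ "{i. x i \<noteq> 0} \<union> {i. y i \<noteq> 0}"]) auto
  done

lift_definition uminus_fvec :: "fvec \<Rightarrow> fvec" is "\<lambda>x i. - x i" by simp

lift_definition minus_fvec :: "fvec \<Rightarrow> fvec \<Rightarrow> fvec" is "\<lambda>x y i. x i - y i"
  subgoal for x y by (rule finite_subset[of _ "{i. x i \<noteq> 0} \<union> {i. y i \<noteq> 0}"]) auto
  done

lift_definition scaleR_fvec :: "real \<Rightarrow> fvec \<Rightarrow> fvec" is "\<lambda>r x i. r * x i"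
  subgoal for r x by (rule finite_subset[of _ "{i. x i \<noteq> 0}"]) auto
  done

instance
  by standard (transfer, simp add: fun_eq_iff algebra_simps)+

end

instantiation fvec :: real_inner
begin

definition inner_fvec :: "fvec \<Rightarrow> fvec \<Rightarrow> real" where
  "inner_fvec x y = (\<Sum>i | coord x i \<noteq> 0. coord x i * coord y i)"

definition norm_fvec :: "fvec \<Rightarrow> real" where
  "norm_fvec x = sqrt (inner x x)"

definition sgn_fvec :: "fvec \<Rightarrow> fvec" where
  "sgn_fvec x = x /\<^sub>R norm x"

definition dist_fvec :: "fvec \<Rightarrow> fvec \<Rightarrow> real" where
  "dist_fvec x y = norm (x - y)"

definition uniformity_fvec :: "(fvec \<times> fvec) filter" where
  "uniformity_fvec = (INF e\<in>{0<..}. principal {(x, y). dist x y < e})"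

definition open_fvec :: "fvec set \<Rightarrow> bool" where
  "open_fvec U \<longleftrightarrow> (\<forall>x\<in>U. \<forall>\<^sub>F (x', y) in uniformity. x' = x \<longrightarrow> y \<in> U)"

lemma inner_fvec_superset:
  assumes "finite S" "{i. coord x i \<noteq> 0} \<subseteq> S"
  shows "inner x y = (\<Sum>i\<in>S. coord x i * coord y i)"
  unfolding inner_fvec_def using assms by (intro sum.mono_neutral_left) auto

instance
proof
  fix x y z :: fvec and r :: real
  let ?S = "{i. coord x i \<noteq> 0} \<union> {i. coord y i \<noteq> 0} \<union> {i. coord z i \<noteq> 0}"
  have S: "finite ?S" by simp
  show "sgn x = x /\<^sub>R norm x" by (rule sgn_fvec_def)
  show "dist x y = norm (x - y)" by (rule dist_fvec_def)
  show "uniformity = (INF e\<in>{0<..}. principal {(x, y::fvec). dist x y < e})"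
    by (rule uniformity_fvec_def)
  show "open U = (\<forall>x\<in>U. \<forall>\<^sub>F (x', y) in uniformity. x' = x \<longrightarrow> y \<in> U)" for U :: "fvec set"
    by (rule open_fvec_def)
  show "inner x y = inner y x"
    by (subst (1 2) inner_fvec_superset[OF S]) (auto simp: mult.commute)
  show "inner (x + y) z = inner x z + inner y z"
    by (subst (1 2 3) inner_fvec_superset[OF S])
       (auto simp: plus_fvec.rep_eq sum.distrib algebra_simps)
  show "inner (r *\<^sub>R x) y = r * inner x y"
    by (subst (1 2) inner_fvec_superset[OF S])
       (auto simp: scaleR_fvec.rep_eq sum_distrib_left algebra_simps)
  show "0 \<le> inner x x" by (simp add: inner_fvec_def sum_nonneg)
  show "inner x x = 0 \<longleftrightarrow> x = 0"
    by (auto simp: inner_fvec_def sum_nonneg_eq_0_iff zero_fvec.rep_eq intro: fvec_eqI)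
  show "norm x = sqrt (inner x x)" by (rule norm_fvec_def)
qed

end

definition Rd :: "nat \<Rightarrow> fvec set" where
  "Rd d = {x. \<forall>i\<ge>d. coord x i = 0}"

lemma inner_Rd:
  assumes "x \<in> Rd d"
  shows "inner x y = (\<Sum>i<d. coord x i * coord y i)"
proof (rule inner_fvec_superset)
  show "{i. coord x i \<noteq> 0} \<subseteq> {..<d}"
    using assms by (auto simp: Rd_def simp flip: not_le)
qed simp

lemma Rd_coordinates: "bij_betw (\<lambda>x. restrict (coord x) {..<d}) (Rd d) ({..<d} \<rightarrow>\<^sub>E UNIV)"
proof (rule bij_betw_byWitness[where f' = "\<lambda>c. fvec_of (\<lambda>i. if i < d then c i else 0)"])
  have fin: "coord (fvec_of (\<lambda>i. if i < d then c i else 0)) = (\<lambda>i. if i < d then c i else 0)"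
    for c :: "nat \<Rightarrow> real"
    by (rule fvec_of_inverse) (auto intro: finite_subset[of _ "{..<d}"])
  show "\<forall>x\<in>Rd d. fvec_of (\<lambda>i. if i < d then restrict (coord x) {..<d} i else 0) = x"
    by (intro ballI fvec_eqI) (unfold fin, auto simp: Rd_def)
  show "\<forall>c\<in>{..<d} \<rightarrow>\<^sub>E UNIV.
      restrict (coord (fvec_of (\<lambda>i. if i < d then c i else 0))) {..<d} = c"
    by (unfold fin) (simp add: PiE_def extensional_def restrict_def fun_eq_iff)
  show "(\<lambda>c. fvec_of (\<lambda>i. if i < d then c i else 0)) ` ({..<d} \<rightarrow>\<^sub>E UNIV) \<subseteq> Rd d"
    unfolding Rd_def by (intro image_subsetI) (simp add: fin)
qed (simp add: image_subset_iff)

definition F0inf :: "nat \<Rightarrow> (fvec \<Rightarrow> real) set" where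
  "F0inf d = {f. convex_on (Rd d) f \<and> f differentiable_on (Rd d)}"

text \<open>The derivative of \<open>f\<close> within \<open>Rd d\<close> is only determined on \<open>Rd d\<close>; the gradient is the
  unique vector of \<open>Rd d\<close> representing it.\<close>

definition is_gradient :: "nat \<Rightarrow> (fvec \<Rightarrow> real) \<Rightarrow> fvec \<Rightarrow> fvec \<Rightarrow> bool" where
  "is_gradient d f x g \<longleftrightarrow>
     g \<in> Rd d \<and> (f has_derivative (\<lambda>h. inner g h)) (at x within Rd d)"

definition grad :: "nat \<Rightarrow> (fvec \<Rightarrow> real) \<Rightarrow> fvec \<Rightarrow> fvec" where
  "grad d f x = (THE g. is_gradient d f x g)"

lemma coord_sum: "coord (\<Sum>i\<in>A. x i) j = (\<Sum>i\<in>A. coord (x i) j)"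
  by (induction A rule: infinite_finite_induct) (simp_all add: zero_fvec.rep_eq plus_fvec.rep_eq)

lemma is_gradient_unique:
  assumes x: "x \<in> Rd d" and g1: "is_gradient d f x g1" and g2: "is_gradient d f x g2"
  shows "g1 = g2"
proof -
  define h where "h = g1 - g2"
  have h: "x + s *\<^sub>R h \<in> Rd d" for s
    using x g1 g2
    by (auto simp: h_def is_gradient_def Rd_def plus_fvec.rep_eq scaleR_fvec.rep_eq minus_fvec.rep_eq)
  have der: "((\<lambda>s::real. f (x + s *\<^sub>R h)) has_derivative (\<lambda>s. inner g (s *\<^sub>R h))) (at 0)"
    if "is_gradient d f x g" for g
  proof -
    have p: "((\<lambda>s::real. x + s *\<^sub>R h) has_derivative (\<lambda>s. s *\<^sub>R h)) (at 0)"
      by (auto intro!: derivative_eq_intros)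
    have "(f has_derivative (\<lambda>h. inner g h)) (at x within range (\<lambda>s. x + s *\<^sub>R h))"
      using that h by (auto simp: is_gradient_def intro: has_derivative_subset)
    then show ?thesis
      using has_derivative_in_compose[OF p, of f "\<lambda>h. inner g h"] by simp
  qed
  have "inner g1 (1 *\<^sub>R h) = inner g2 (1 *\<^sub>R h)"
    using has_derivative_unique[OF der[OF g1] der[OF g2]] by meson
  then have "inner h h = 0" by (simp add: h_def inner_diff_left)
  then show ?thesis by (simp add: h_def)
qed

lemma is_gradient_exists:
  assumes "f differentiable (at x within Rd d)" "x \<in> Rd d"
  shows "\<exists>g. is_gradient d f x g"
proof -
  obtain D where D: "(f has_derivative D) (at x within Rd d)"
    using assms by (auto simp: differentiable_def)
  interpret D: bounded_linear D using D by (rule has_derivative_bounded_linear)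
  define e where "e = (\<lambda>i. fvec_of (\<lambda>j. if j = i then 1 else 0))"
  have e: "coord (e i) j = (if j = i then 1 else 0)" for i j
    unfolding e_def by (subst fvec_of_inverse) auto
  define g where "g = (\<Sum>i<d. D (e i) *\<^sub>R e i)"
  have cg: "coord g j = (if j < d then D (e j) else 0)" for j
    by (simp add: g_def coord_sum scaleR_fvec.rep_eq e if_distrib cong: if_cong)
  have g: "g \<in> Rd d" by (simp add: Rd_def cg)
  have Dg: "D h = inner g h" if "h \<in> Rd d" for h
  proof -
    have "h = (\<Sum>i<d. coord h i *\<^sub>R e i)"
      using that
      by (intro fvec_eqI)
         (auto simp: coord_sum scaleR_fvec.rep_eq e Rd_def if_distrib not_less cong: if_cong)
    then have "D h = D (\<Sum>i<d. coord h i *\<^sub>R e i)" by simp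
    also have "\<dots> = (\<Sum>i<d. coord h i * D (e i))" by (simp add: D.sum D.scaleR)
    also have "\<dots> = inner g h" by (simp add: inner_Rd[OF g] cg mult.commute)
    finally show ?thesis .
  qed
  have "y - x \<in> Rd d" if "y \<in> Rd d" for y
    using that assms(2) by (auto simp: Rd_def minus_fvec.rep_eq)
  then have ev: "\<forall>\<^sub>F y in at x within Rd d. (f y - f x - D (y - x)) /\<^sub>R norm (y - x)
      = (f y - f x - inner g (y - x)) /\<^sub>R norm (y - x)"
    by (auto simp: eventually_at_topological Dg intro!: exI[of _ UNIV])
  have "(f has_derivative (\<lambda>h. inner g h)) (at x within Rd d)"
    using D tendsto_cong[OF ev]
    by (auto simp: has_derivative_at_within bounded_linear_inner_right)
  then show ?thesis using g by (auto simp: is_gradient_def)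
qed

lemma is_gradient_grad:
  assumes "f \<in> F0inf d" "x \<in> Rd d"
  shows "is_gradient d f x (grad d f x)"
proof -
  have "\<exists>!g. is_gradient d f x g"
    using is_gradient_exists is_gradient_unique assms
    by (metis (no_types, lifting) F0inf_def differentiable_on_def mem_Collect_eq)
  then show ?thesis unfolding grad_def by (rule theI')
qed

definition velocity :: "(real \<Rightarrow> fvec) \<Rightarrow> real \<Rightarrow> fvec" where
  "velocity X t = vector_derivative X (at t)"

text \<open>No initial condition is imposed: the trajectories are all solutions on \<open>t > 0\<close>.\<close>

definition agf_trajectory :: "nat \<Rightarrow> (fvec \<Rightarrow> real) \<Rightarrow> (real \<Rightarrow> fvec) \<Rightarrow> bool" where
  "agf_trajectory d f X \<longleftrightarrow> (\<forall>t>0.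
     X t \<in> Rd d \<and> X differentiable (at t) \<and> velocity X differentiable (at t) \<and>
     vector_derivative (velocity X) (at t) + (3 / t) *\<^sub>R velocity X t + grad d f (X t) = 0)"

definition psd :: "real^'n^'n \<Rightarrow> bool" where
  "psd M \<longleftrightarrow> transpose M = M \<and> (\<forall>x. 0 \<le> inner x (M *v x))"

definition nsd :: "real^'n^'n \<Rightarrow> bool" where
  "nsd M \<longleftrightarrow> transpose M = M \<and> (\<forall>x. inner x (M *v x) \<le> 0)"

definition P_mat :: "real \<Rightarrow> real \<Rightarrow> real \<Rightarrow> real^2^2" where
  "P_mat p11 p12 p22 = vector [vector [p11, p12], vector [p12, p22]]"

text \<open>Rows and columns of a Kronecker product are indexed by pairs (block, position in block).\<close>

definition kronecker :: "real^'n^'n \<Rightarrow> (nat \<Rightarrow> nat \<Rightarrow> real) \<Rightarrow> 'n \<times> nat \<Rightarrow> 'n \<times> nat \<Rightarrow> real" where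
  "kronecker A B = (\<lambda>(i, k) (j, l). A $ i $ j * B k l)"

definition id_mat :: "nat \<Rightarrow> nat \<Rightarrow> real" where
  "id_mat k l = (if k = l then 1 else 0)"

definition stack :: "fvec \<Rightarrow> fvec \<Rightarrow> 2 \<times> nat \<Rightarrow> real" where
  "stack x v = (\<lambda>(i, k). coord (if i = 1 then x else v) k)"

definition quad_form :: "'i set \<Rightarrow> ('i \<Rightarrow> 'i \<Rightarrow> real) \<Rightarrow> ('i \<Rightarrow> real) \<Rightarrow> real" where
  "quad_form I M z = (\<Sum>\<alpha>\<in>I. \<Sum>\<beta>\<in>I. z \<alpha> * M \<alpha> \<beta> * z \<beta>)"

definition lyapunov ::
  "nat \<Rightarrow> (real \<Rightarrow> real) \<Rightarrow> (real \<Rightarrow> real^2^2) \<Rightarrow> (fvec \<Rightarrow> real) \<Rightarrow> fvec \<Rightarrow> (real \<Rightarrow> fvec) \<Rightarrow> real \<Rightarrow> real"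
where
  "lyapunov d a P f xs X t =
     a t * (f (X t) - f xs) +
     quad_form (UNIV \<times> {..<d}) (kronecker (P t) id_mat) (stack (X t - xs) (velocity X t))"

lemma quad_form_kronecker_id:
  assumes "x \<in> Rd d" "v \<in> Rd d"
  shows "quad_form (UNIV \<times> {..<d}) (kronecker (P_mat p11 p12 p22) id_mat) (stack x v) =
    p11 * inner x x + 2 * p12 * inner x v + p22 * inner v v"
proof -
  have delta: "(\<Sum>l<d. c * (p * id_mat k l) * b l) = c * p * b k" if "k < d"
    for c p :: real and b k
  proof -
    have "(\<Sum>l<d. c * (p * id_mat k l) * b l) = (\<Sum>l<d. if k = l then c * p * b l else 0)"
      by (intro sum.cong) (auto simp: id_mat_def)
    then show ?thesis using that by simp
  qed
  have "quad_form (UNIV \<times> {..<d}) (kronecker (P_mat p11 p12 p22) id_mat) (stack x v) =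
    (\<Sum>k<d. p11 * (coord x k * coord x k) + 2 * p12 * (coord x k * coord v k)
          + p22 * (coord v k * coord v k))"
    unfolding quad_form_def sum.cartesian_product'
    by (simp add: sum_2 kronecker_def stack_def P_mat_def delta flip: sum.distrib)
       (simp add: algebra_simps)
  also have "\<dots> = p11 * inner x x + 2 * p12 * inner x v + p22 * inner v v"
    by (simp add: inner_Rd[OF assms(1)] inner_Rd[OF assms(2)] sum.distrib sum_distrib_left)
  finally show ?thesis .
qed

text \<open>The arguments are the values at time \<open>t\<close> of \<open>a\<close>, \<open>p11\<close>, \<open>p12\<close>, \<open>p22\<close>, of the derivatives
  \<open>p11'\<close>, \<open>p12'\<close>, \<open>p22'\<close>, and of the multiplier \<open>\<lambda>1\<close>.\<close>

definition lmi_mat ::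
  "real \<Rightarrow> real \<Rightarrow> real \<Rightarrow> real \<Rightarrow> real \<Rightarrow> real \<Rightarrow> real \<Rightarrow> real \<Rightarrow> real \<Rightarrow> real^3^3"
where
  "lmi_mat t a p11 p12 p22 p11' p12' p22' l1 = vector
     [vector [p11',                        p11 - 3 / t * p12 + p12',           - p12 + l1 / 2],
      vector [p11 - 3 / t * p12 + p12',    2 * (p12 - 3 / t * p22) + p22',     - p22 + a / 2],
      vector [- p12 + l1 / 2,              - p22 + a / 2,                      0]]"

end

(* At a time t the derivative of the Lyapunov function is affine in f(X) - f_star, <v, g> and
   <x, g>, plus a quadratic form in x = X - x_star and v.  Since the matrix of (ii) has a zero in
   its corner, (ii) amounts to a = 2 p22, lambda1 = 2 p12 >= 0, lambda2 = 2 p12 - a' >= 0 and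
   negativity of that quadratic form, and decrease follows from
   0 <= f(X) - f_star <= <x, g>.

   Conversely dimension one suffices.  Let f have slope 0 on the negative axis, K beyond delta, and
   a linear slope in between, with minimizer -R <= 0.  The flow is globally solvable with arbitrary
   position and velocity at time t, so decrease gives an inequality in K, delta, R, position and
   velocity.  K = 0 yields the quadratic form; letting first K -> infinity and then delta -> 0
   yields a = 2 p22 (position delta, velocities of both signs, R = 0), a' <= 2 p12 (position 1, where
   f - f_star is nearly <x, g>) and p12 >= 0 (position delta, R = 1, where it is nearly 0). *)

theory Submission
  imports Defs
begin

section \<open>Global solutions of ordinary differential equations\<close>

text \<open>Mean value inequality with a comparison function \<open>\<phi>\<close> in place of a
  constant. The absolute value covers both orders of \<open>s\<close> and \<open>t\<close>, since
  estimates are needed before and after the initial time.\<close>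

lemma vector_derivative_bound_between:
  fixes f :: "real \<Rightarrow> 'a::real_normed_vector"
  assumes f: "\<And>x. (f has_vector_derivative f' x) (at x)"
    and \<phi>: "\<And>x. (\<phi> has_real_derivative \<phi>' x) (at x)"
    and le: "\<And>x. norm (f' x) \<le> \<phi>' x"
  shows "norm (f t - f s) \<le> \<bar>\<phi> t - \<phi> s\<bar>"
proof -
  have *: "norm (f b - f a) \<le> \<phi> b - \<phi> a" if "a < b" for a b
  proof (rule differentiable_bound_general[OF that])
    show "continuous_on {a..b} f"
      using f by (meson continuous_at_imp_continuous_on has_vector_derivative_continuous)
    show "continuous_on {a..b} \<phi>"
      using \<phi> by (meson continuous_at_imp_continuous_on DERIV_isCont)
  qed (use f \<phi> le in \<open>auto simp: has_real_derivative_iff_has_vector_derivative\<close>)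
  consider "s < t" | "s = t" | "t < s" by linarith
  then show ?thesis
    using *[of s t] *[of t s] by cases (auto simp: norm_minus_commute)
qed

text \<open>Stands in for the oriented integral of \<open>h\<close> from \<open>t0\<close>, on both
  sides of \<open>t0\<close>.\<close>

lemma continuous_has_antiderivative:
  fixes h :: "real \<Rightarrow> 'a::euclidean_space"
  assumes "continuous_on UNIV h"
  shows "\<exists>G. G t0 = 0 \<and> (\<forall>t. (G has_vector_derivative h t) (at t))"
proof -
  obtain G where G: "\<And>t. (G has_vector_derivative h t) (at t)"
    using einterval_antiderivative[of "-\<infinity>" "\<infinity>" h] assms
    by (auto simp: continuous_on_eq_continuous_at)
  then show ?thesis
    by (intro exI[of _ "\<lambda>t. G t - G t0"]) (auto intro!: derivative_eq_intros)
qed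

text \<open>Picard iteration in a norm weighted by \<open>2 * cosh (2 * M)\<close>, with \<open>M\<close> an
  antiderivative of the Lipschitz constant: the weight makes it a contraction on the whole real
  line at once, so that no local solutions have to be glued.\<close>

lemma global_solution_exists:
  fixes F :: "real \<Rightarrow> 'a::euclidean_space \<Rightarrow> 'a"
  assumes cont: "continuous_on UNIV (\<lambda>(t, x). F t x)"
    and \<Lambda>: "\<And>t. (\<Lambda> has_real_derivative L t) (at t)"
    and lip: "\<And>t x y. norm (F t x - F t y) \<le> L t * norm (x - y)"
    and bd: "\<And>t. norm (F t z0) \<le> L t"
  obtains z where "z t0 = z0" "\<And>t. (z has_vector_derivative F t (z t)) (at t)"
proof -
  define M where "M = (\<lambda>t. \<Lambda> t - \<Lambda> t0)"
  define w where "w = (\<lambda>t. 2 * cosh (2 * M t))"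
  \<comment> \<open>\<open>S\<close> is the antiderivative of \<open>L * w\<close> that vanishes at
    \<open>t0\<close>; the estimate of \<open>\<bar>S t\<bar>\<close> by \<open>w t / 2\<close> is
    the source of the contraction factor 1/2.\<close>
  define S where "S = (\<lambda>t. sinh (2 * M t))"
  have M: "(M has_real_derivative L t) (at t)" for t
    unfolding M_def by (auto intro!: derivative_eq_intros \<Lambda>)
  have S: "(S has_real_derivative L t * w t) (at t)" for t
    unfolding S_def w_def by (auto intro!: derivative_eq_intros M simp: algebra_simps)
  have S0: "S t0 = 0" by (simp add: S_def M_def)
  have Sw: "\<bar>S t\<bar> \<le> w t / 2" for t
    using sinh_less_cosh_real[of "\<bar>2 * M t\<bar>"]
    by (simp add: S_def w_def del: sinh_less_cosh_real abs_mult)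
  have L0: "0 \<le> L t" for t
    using order_trans[OF norm_ge_zero bd] .
  have w1: "1 \<le> w t" for t
    using cosh_real_ge_1[of "2 * M t"] by (simp add: w_def del: cosh_real_ge_1)
  have w0: "0 < w t" for t using w1[of t] by linarith
  have wcont: "continuous_on T w" for T
    unfolding w_def using M
    by (intro continuous_intros continuous_at_imp_continuous_on ballI DERIV_isCont)
  \<comment> \<open>The unknown is the bounded function \<open>B = (z - z0) / w\<close>, so that the
    weighted norm of \<open>z - z0\<close> becomes the supremum norm of \<open>B\<close>.\<close>
  define H where "H = (\<lambda>(B::real \<Rightarrow>\<^sub>C 'a) t. F t (z0 + w t *\<^sub>R apply_bcontfun B t))"
  have Hcont: "continuous_on UNIV (H B)" for B
  proof -
    have "continuous_on UNIV (\<lambda>t. (t, z0 + w t *\<^sub>R apply_bcontfun B t))"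
      by (intro continuous_intros wcont continuous_on_apply_bcontfun)
    from continuous_on_compose2[OF cont this] show ?thesis by (simp add: H_def)
  qed
  obtain I where I0: "\<And>B. I B t0 = 0"
    and I: "\<And>B t. (I B has_vector_derivative H B t) (at t)"
    using continuous_has_antiderivative[OF Hcont, of t0] by metis
  have Icont: "continuous_on UNIV (I B)" for B
    using I by (meson continuous_at_imp_continuous_on has_vector_derivative_continuous)
  \<comment> \<open>Serves twice: with \<open>c = 1 + norm B\<close> it keeps the Picard integral
    bounded after division by \<open>w\<close>, and with \<open>c = dist B C\<close> it gives the
    contraction.\<close>
  have bound: "norm (J t) \<le> c * w t / 2"
    if "J t0 = 0" "\<And>t. (J has_vector_derivative h t) (at t)" "\<And>t. norm (h t) \<le> c * (L t * w t)"
      "0 \<le> c" for J h c t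
  proof -
    have "norm (J t - J t0) \<le> \<bar>c * S t - c * S t0\<bar>"
      by (rule vector_derivative_bound_between[OF that(2) DERIV_cmult[OF S] that(3)])
    also have "\<dots> = c * \<bar>S t\<bar>" using that by (simp add: S0 abs_mult)
    also have "\<dots> \<le> c * (w t / 2)" using that Sw by (intro mult_left_mono)
    finally show ?thesis using that by simp
  qed
  have Hbound: "norm (H B t) \<le> (1 + norm B) * (L t * w t)" for B t
  proof -
    have "norm (H B t) \<le> norm (F t z0) + norm (H B t - F t z0)"
      using norm_triangle_sub[of "H B t" "F t z0"] by simp
    also have "\<dots> \<le> L t + L t * (w t * norm (apply_bcontfun B t))"
      using lip[of t "z0 + w t *\<^sub>R apply_bcontfun B t" z0] bd[of t] w0[of t] by (simp add: H_def)
    also have "\<dots> \<le> L t * w t + L t * (w t * norm B)"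
      using L0[of t] w1[of t] w0[of t] norm_bounded[of B t]
      by (intro add_mono mult_left_mono) (auto simp: mult_le_cancel_left1)
    finally show ?thesis by (simp add: algebra_simps)
  qed
  have Hdiff: "norm (H B t - H C t) \<le> dist B C * (L t * w t)" for B C t
  proof -
    have "norm (H B t - H C t)
        \<le> L t * norm (w t *\<^sub>R apply_bcontfun B t - w t *\<^sub>R apply_bcontfun C t)"
      using lip[of t "z0 + w t *\<^sub>R apply_bcontfun B t" "z0 + w t *\<^sub>R apply_bcontfun C t"]
      by (simp add: H_def)
    also have "\<dots> = L t * (w t * dist (apply_bcontfun B t) (apply_bcontfun C t))"
      using w0[of t] by (simp add: dist_norm flip: scaleR_diff_right)
    also have "\<dots> \<le> L t * (w t * dist B C)"
      using L0[of t] w0[of t] by (intro mult_left_mono dist_bounded) auto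
    finally show ?thesis by (simp add: algebra_simps)
  qed
  have bc: "(\<lambda>t. I B t /\<^sub>R w t) \<in> bcontfun" for B
  proof (rule bcontfun_normI)
    show "continuous_on UNIV (\<lambda>t. I B t /\<^sub>R w t)"
      using w0 by (intro continuous_intros Icont wcont) (simp add: less_imp_neq[THEN not_sym])
    show "norm (I B t /\<^sub>R w t) \<le> (1 + norm B) / 2" for t
      using bound[OF I0 I Hbound, of B t] w0[of t] by (simp add: field_simps)
  qed
  define \<Phi> where "\<Phi> = (\<lambda>B. Bcontfun (\<lambda>t. I B t /\<^sub>R w t))"
  have \<Phi>: "apply_bcontfun (\<Phi> B) t = I B t /\<^sub>R w t" for B t
    unfolding \<Phi>_def by (simp add: Bcontfun_inverse[OF bc])
  have contr: "dist (\<Phi> B) (\<Phi> C) \<le> 1 / 2 * dist B C" for B C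
  proof (rule dist_bound)
    fix t
    have "norm (I B t - I C t) \<le> dist B C * w t / 2"
      by (rule bound[OF _ _ Hdiff]) (auto simp: I0 intro!: derivative_eq_intros I)
    then have "norm (I B t - I C t) / w t \<le> 1 / 2 * dist B C"
      using w0[of t] by (simp add: field_simps)
    moreover have "dist (apply_bcontfun (\<Phi> B) t) (apply_bcontfun (\<Phi> C) t) = norm (I B t - I C t) / w t"
      using w0[of t] unfolding \<Phi> dist_norm scaleR_diff_right[symmetric] norm_scaleR
      by (simp add: divide_inverse)
    ultimately show "dist (apply_bcontfun (\<Phi> B) t) (apply_bcontfun (\<Phi> C) t) \<le> 1 / 2 * dist B C"
      by linarith
  qed
  \<comment> \<open>The fixed point equation says that \<open>w * B\<close> is its own Picard
    integral \<open>I B\<close>; adding \<open>z0\<close> yields the solution.\<close>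
  obtain B where B: "\<Phi> B = B"
    using banach_fix_type[of "1/2" \<Phi>] contr by auto
  define z where "z = (\<lambda>t. z0 + I B t)"
  have "w t *\<^sub>R apply_bcontfun B t = I B t" for t
    using \<Phi>[of B t] w0[of t] by (simp add: B)
  then have "H B t = F t (z t)" for t
    by (simp add: H_def z_def)
  then have "(z has_vector_derivative F t (z t)) (at t)" for t
    unfolding z_def using I[of B t] by (auto intro!: derivative_eq_intros)
  moreover have "z t0 = z0" by (simp add: z_def I0)
  ultimately show ?thesis by (rule that[rotated])
qed

text \<open>With respect to the time \<open>\<tau> = ln t\<close> the first-order system lives on the whole real line.\<close>

lemma scalar_agf_solution_exists:
  fixes g :: "real \<Rightarrow> real"
  assumes lip: "\<And>x y. \<bar>g x - g y\<bar> \<le> C * \<bar>x - y\<bar>" and t0: "t0 > 0"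
  obtains x v where "x t0 = x0" "v t0 = v0"
    "\<And>t. t > 0 \<Longrightarrow> (x has_real_derivative v t) (at t)"
    "\<And>t. t > 0 \<Longrightarrow> (v has_real_derivative - (3 / t) * v t - g (x t)) (at t)"
proof -
  \<comment> \<open>Multiplying both equations by \<open>t = exp \<tau>\<close> turns the singular
    coefficient \<open>3 / t\<close> into the constant 3. The second component remains the velocity
    with respect to \<open>t\<close>.\<close>
  define F where "F = (\<lambda>(\<tau>::real) (p::real \<times> real).
    (exp \<tau> * snd p, - 3 * snd p - exp \<tau> * g (fst p)))"
  \<comment> \<open>Chosen so large that \<open>N * (1 + exp \<tau>)\<close>, which has an explicit
    antiderivative, dominates both the Lipschitz constant of \<open>F \<tau>\<close> and its value
    at the initial point.\<close>
  define N where "N = 3 + C + 3 * \<bar>v0\<bar> + \<bar>g x0\<bar>"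
  have C0: "0 \<le> C" using order_trans[OF abs_ge_zero lip[of 1 0]] by simp
  have norm_Pair_le: "norm (a, b) \<le> \<bar>a\<bar> + \<bar>b\<bar>" for a b :: real
    using norm_Pair_le[of a b] by simp
  have gcont: "continuous_on T g" for T
  proof (rule lipschitz_on_continuous_on)
    show "C-lipschitz_on T g" using lip C0 by (auto simp: lipschitz_on_def dist_real_def)
  qed
  have Fcont: "continuous_on UNIV (\<lambda>(\<tau>, p). F \<tau> p)"
    unfolding F_def split_beta
    by (intro continuous_intros continuous_on_compose2[OF gcont[of UNIV]]) auto
  have \<Lambda>: "((\<lambda>\<tau>. N * (\<tau> + exp \<tau>)) has_real_derivative N * (1 + exp \<tau>)) (at \<tau>)" for \<tau>
    by (auto intro!: derivative_eq_intros)
  have Flip: "norm (F \<tau> p - F \<tau> q) \<le> N * (1 + exp \<tau>) * norm (p - q)" for \<tau> p q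
  proof -
    have fst: "\<bar>fst p - fst q\<bar> \<le> norm (p - q)"
      by (metis fst_diff norm_fst_le prod.collapse real_norm_def)
    have snd: "\<bar>snd p - snd q\<bar> \<le> norm (p - q)"
      by (metis snd_diff norm_snd_le prod.collapse real_norm_def)
    have "norm (F \<tau> p - F \<tau> q)
        \<le> \<bar>exp \<tau> * (snd p - snd q)\<bar>
          + \<bar>- 3 * (snd p - snd q) - exp \<tau> * (g (fst p) - g (fst q))\<bar>"
      using norm_Pair_le[of "exp \<tau> * (snd p - snd q)"
          "- 3 * (snd p - snd q) - exp \<tau> * (g (fst p) - g (fst q))"]
      by (simp add: F_def algebra_simps)
    also have "\<dots> \<le> exp \<tau> * \<bar>snd p - snd q\<bar>
        + (3 * \<bar>snd p - snd q\<bar> + exp \<tau> * \<bar>g (fst p) - g (fst q)\<bar>)"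
      using abs_triangle_ineq4[of "- 3 * (snd p - snd q)" "exp \<tau> * (g (fst p) - g (fst q))"]
      unfolding abs_mult by simp
    also have "\<dots> \<le> exp \<tau> * norm (p - q)
        + (3 * norm (p - q) + exp \<tau> * (C * norm (p - q)))"
      using fst snd C0 order_trans[OF lip mult_left_mono[OF fst C0]]
      by (intro add_mono mult_left_mono) auto
    also have "\<dots> = (exp \<tau> + 3 + exp \<tau> * C) * norm (p - q)"
      by (simp add: algebra_simps)
    also have "\<dots> \<le> N * (1 + exp \<tau>) * norm (p - q)"
      using C0 by (intro mult_right_mono) (simp_all add: N_def algebra_simps add_nonneg_nonneg)
    finally show ?thesis .
  qed
  have Fbd: "norm (F \<tau> (x0, v0)) \<le> N * (1 + exp \<tau>)" for \<tau>
  proof -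
    have "norm (F \<tau> (x0, v0)) \<le> exp \<tau> * \<bar>v0\<bar> + (3 * \<bar>v0\<bar> + exp \<tau> * \<bar>g x0\<bar>)"
      using norm_Pair_le[of "exp \<tau> * v0" "- 3 * v0 - exp \<tau> * g x0"]
        abs_triangle_ineq4[of "- 3 * v0" "exp \<tau> * g x0"]
      by (simp add: F_def abs_mult)
    also have "\<dots> \<le> N * (1 + exp \<tau>)"
      using C0 by (simp add: N_def algebra_simps add_nonneg_nonneg)
    finally show ?thesis .
  qed
  obtain z where z0: "z (ln t0) = (x0, v0)"
    and z: "\<And>\<tau>. (z has_vector_derivative F \<tau> (z \<tau>)) (at \<tau>)"
    using global_solution_exists[OF Fcont \<Lambda> Flip Fbd] by metis
  have fz: "((\<lambda>\<tau>. fst (z \<tau>)) has_real_derivative exp \<tau> * snd (z \<tau>)) (at \<tau>)" for \<tau>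
    using bounded_linear.has_vector_derivative[OF bounded_linear_fst z[of \<tau>]]
    by (simp add: F_def has_real_derivative_iff_has_vector_derivative)
  have sz: "((\<lambda>\<tau>. snd (z \<tau>)) has_real_derivative
      - 3 * snd (z \<tau>) - exp \<tau> * g (fst (z \<tau>))) (at \<tau>)" for \<tau>
    using bounded_linear.has_vector_derivative[OF bounded_linear_snd z[of \<tau>]]
    by (simp add: F_def has_real_derivative_iff_has_vector_derivative)
  show ?thesis
  proof (rule that[of "\<lambda>t. fst (z (ln t))" "\<lambda>t. snd (z (ln t))"])
    show "((\<lambda>t. fst (z (ln t))) has_real_derivative snd (z (ln t))) (at t)" if "t > 0" for t
      using DERIV_chain2[OF fz DERIV_ln_divide[OF that]] that by simp
    show "((\<lambda>t. snd (z (ln t))) has_real_derivative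
        - (3 / t) * snd (z (ln t)) - g (fst (z (ln t)))) (at t)" if "t > 0" for t
      using DERIV_chain2[OF sz DERIV_ln_divide[OF that]] that by (simp add: field_simps)
  qed (simp_all add: z0)
qed

section \<open>One-dimensional problems embedded along a unit vector\<close>

definition e0 :: fvec where "e0 = fvec_of (\<lambda>i. if i = 0 then 1 else 0)"

lemma coord_e0: "coord e0 i = (if i = 0 then 1 else 0)"
  unfolding e0_def by (subst fvec_of_inverse) auto

lemma scaleR_e0_in_Rd: "r *\<^sub>R e0 \<in> Rd 1"
  by (auto simp: Rd_def scaleR_fvec.rep_eq coord_e0)

lemma inner_e0 [simp]: "inner e0 y = coord y 0"
  by (subst inner_Rd[of _ 1]) (simp_all add: Rd_def coord_e0)

lemma coord_scaleR_e0 [simp]: "coord (r *\<^sub>R e0) 0 = r"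
  by (simp add: scaleR_fvec.rep_eq coord_e0)

lemma coord_e0_0 [simp]: "coord e0 0 = 1"
  by (simp add: coord_e0)

lemma convex_Rd: "convex (Rd d)"
  by (auto simp: convex_def Rd_def plus_fvec.rep_eq scaleR_fvec.rep_eq)

lemma has_derivative_e0_line:
  assumes "\<And>r. (\<phi> has_real_derivative \<phi>' r) (at r)"
  shows "((\<lambda>y. \<phi> (inner e0 y)) has_derivative (\<lambda>h. inner (\<phi>' (inner e0 y) *\<^sub>R e0) h)) (at y within S)"
proof -
  have "((\<lambda>y. inner e0 y) has_derivative (\<lambda>h. inner e0 h)) (at y within S)"
    by (rule bounded_linear_imp_has_derivative[OF bounded_linear_inner_right])
  from has_derivative_compose[OF this assms[unfolded has_field_derivative_def]]
  show ?thesis by simp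
qed

lemma line_function_F0inf:
  assumes "\<And>r. (\<phi> has_real_derivative \<phi>' r) (at r)" "mono \<phi>'"
  shows "(\<lambda>y. \<phi> (inner e0 y)) \<in> F0inf 1"
proof -
  have c: "convex_on UNIV \<phi>"
    by (rule convex_on_realI[where f' = \<phi>']) (use assms in \<open>auto simp: mono_def\<close>)
  have "convex_on (Rd 1) (\<lambda>y. \<phi> (inner e0 y))"
    unfolding convex_on_def
    using c convex_Rd by (auto simp: convex_on_def inner_add_right plus_fvec.rep_eq scaleR_fvec.rep_eq)
  then show ?thesis
    using has_derivative_e0_line[OF assms(1)]
    by (auto simp: F0inf_def differentiable_on_def differentiable_def)
qed

lemma line_function_grad:
  assumes "\<And>r. (\<phi> has_real_derivative \<phi>' r) (at r)" "mono \<phi>'" "y \<in> Rd 1"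
  shows "grad 1 (\<lambda>y. \<phi> (inner e0 y)) y = \<phi>' (inner e0 y) *\<^sub>R e0"
proof (rule is_gradient_unique[OF assms(3) is_gradient_grad[OF line_function_F0inf[OF assms(1,2)] assms(3)]])
  show "is_gradient 1 (\<lambda>y. \<phi> (inner e0 y)) y (\<phi>' (inner e0 y) *\<^sub>R e0)"
    unfolding is_gradient_def using has_derivative_e0_line[OF assms(1)] scaleR_e0_in_Rd by blast
qed

text \<open>Links the scalar system, whose solvability is known, to the flow in \<open>Rd 1\<close>
  of a function of the first coordinate.\<close>

lemma line_trajectory:
  assumes \<phi>: "\<And>r. (\<phi> has_real_derivative \<phi>' r) (at r)" "mono \<phi>'"
    and x: "\<And>t. t > 0 \<Longrightarrow> (x has_real_derivative v t) (at t)"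
    and v: "\<And>t. t > 0 \<Longrightarrow> (v has_real_derivative - (3 / t) * v t - \<phi>' (x t)) (at t)"
  shows "\<And>t. t > 0 \<Longrightarrow> velocity (\<lambda>t. x t *\<^sub>R e0) t = v t *\<^sub>R e0"
    and "agf_trajectory 1 (\<lambda>y. \<phi> (inner e0 y)) (\<lambda>t. x t *\<^sub>R e0)"
proof -
  let ?X = "\<lambda>t. x t *\<^sub>R e0"
  have lift: "((\<lambda>t. u t *\<^sub>R e0) has_vector_derivative u' *\<^sub>R e0) (at t)"
    if "(u has_real_derivative u') (at t)" for u u' t
    using has_vector_derivative_scaleR[OF that has_vector_derivative_const[of e0]] by simp
  show vel: "velocity ?X t = v t *\<^sub>R e0" if "t > 0" for t
    unfolding velocity_def by (rule vector_derivative_at[OF lift[OF x[OF that]]])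
  \<comment> \<open>The formula for the velocity holds only at positive times, so its derivative is
    transferred within the open half-line.\<close>
  have vv: "(velocity ?X has_vector_derivative (- (3 / t) * v t - \<phi>' (x t)) *\<^sub>R e0) (at t)"
    if "t > 0" for t
    by (rule has_vector_derivative_transform_within_open[OF lift[OF v[OF that]],
          where S = "{0<..}"]) (use that vel in auto)
  show "agf_trajectory 1 (\<lambda>y. \<phi> (inner e0 y)) ?X"
    unfolding agf_trajectory_def
  proof (intro allI impI conjI)
    fix t :: real assume t: "t > 0"
    show "?X t \<in> Rd 1" by (rule scaleR_e0_in_Rd)
    show "?X differentiable (at t)" using lift[OF x[OF t]] by (rule differentiableI_vector)
    show "velocity ?X differentiable (at t)" using vv[OF t] by (rule differentiableI_vector)
    have g: "grad 1 (\<lambda>y. \<phi> (inner e0 y)) (?X t) = \<phi>' (x t) *\<^sub>R e0"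
      by (subst line_function_grad[OF \<phi> scaleR_e0_in_Rd]) simp_all
    show "vector_derivative (velocity ?X) (at t) + (3 / t) *\<^sub>R velocity ?X t
        + grad 1 (\<lambda>y. \<phi> (inner e0 y)) (?X t) = 0"
      unfolding g vector_derivative_at[OF vv[OF t]] vel[OF t]
      by (simp flip: scaleR_add_left)
  qed
qed

section \<open>Convex test functions with adjustable slope\<close>

text \<open>Twice the primitive of the positive part, so that differences of shifted copies have
  continuous piecewise linear slopes.\<close>

definition hinge2 :: "real \<Rightarrow> real" where "hinge2 r = (max 0 r)\<^sup>2"

lemma has_real_derivative_hinge2: "(hinge2 has_real_derivative 2 * max 0 r) (at r)"
proof -
  consider "r < 0" | "r > 0" | "r = 0" by linarith
  then show ?thesis
  proof cases
    case 1
    have "((\<lambda>r. 0) has_real_derivative 2 * max 0 r) (at r)" using 1 by simp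
    then show ?thesis
      by (rule has_field_derivative_transform_within_open[where S = "{..<0}"])
        (use 1 in \<open>auto simp: hinge2_def\<close>)
  next
    case 2
    have "((\<lambda>r. r\<^sup>2) has_real_derivative 2 * max 0 r) (at r)"
      using 2 by (auto intro!: derivative_eq_intros)
    then show ?thesis
      by (rule has_field_derivative_transform_within_open[where S = "{0<..}"])
        (use 2 in \<open>auto simp: hinge2_def\<close>)
  next
    case 3
    have "((\<lambda>h. (hinge2 (0 + h) - hinge2 0) / h) \<longlongrightarrow> 0) (at 0)"
    proof (rule Lim_null_comparison)
      have "norm ((hinge2 (0 + h) - hinge2 0) / h) \<le> \<bar>h\<bar>" for h
        by (cases "h > 0") (auto simp: hinge2_def power2_eq_square)
      then show "\<forall>\<^sub>F h in at 0. norm ((hinge2 (0 + h) - hinge2 0) / h) \<le> \<bar>h\<bar>" by simp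
    qed (auto intro!: tendsto_eq_intros)
    then show ?thesis using 3 by (simp add: DERIV_def)
  qed
qed

text \<open>Smoothing at scale \<open>\<delta>\<close> of the function \<open>r \<mapsto> K * max 0 r\<close>.\<close>

definition ramp :: "real \<Rightarrow> real \<Rightarrow> real \<Rightarrow> real" where
  "ramp K \<delta> r = K / (2 * \<delta>) * (hinge2 r - hinge2 (r - \<delta>))"

definition ramp_slope :: "real \<Rightarrow> real \<Rightarrow> real \<Rightarrow> real" where
  "ramp_slope K \<delta> r = K / \<delta> * (max 0 r - max 0 (r - \<delta>))"

lemma has_real_derivative_ramp:
  "(ramp K \<delta> has_real_derivative ramp_slope K \<delta> r) (at r)"
proof -
  have "((\<lambda>r. hinge2 (r - \<delta>)) has_real_derivative 2 * max 0 (r - \<delta>)) (at r)"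
    using DERIV_chain2[where g = "\<lambda>r. r - \<delta>", OF has_real_derivative_hinge2, of 1 r UNIV]
    by (simp add: DERIV_diff[where g = "\<lambda>_. \<delta>", OF DERIV_ident DERIV_const, simplified])
  from DERIV_cmult[OF DERIV_diff[OF has_real_derivative_hinge2[of r] this], of "K / (2 * \<delta>)"]
  show ?thesis
    \<comment> \<open>At \<open>\<delta> = 0\<close> both slopes are 0, as division by zero yields
      0.\<close>
    unfolding ramp_def[abs_def] ramp_slope_def by (rule DERIV_cong) (cases "\<delta> = 0"; simp add: field_simps)
qed

lemma mono_ramp_slope: "0 \<le> K \<Longrightarrow> 0 < \<delta> \<Longrightarrow> mono (ramp_slope K \<delta>)"
  unfolding ramp_slope_def by (intro monoI mult_left_mono) auto

text \<open>The reason for smoothing: for fixed \<open>K\<close> and \<open>\<delta>\<close> the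
  slope is globally Lipschitz, so the flow is globally solvable. The limits in \<open>K\<close> and
  \<open>\<delta>\<close> are taken only later, in an inequality at one time.\<close>

lemma ramp_slope_lipschitz:
  assumes "0 \<le> K" "0 < \<delta>"
  shows "\<bar>ramp_slope K \<delta> r - ramp_slope K \<delta> s\<bar> \<le> K / \<delta> * \<bar>r - s\<bar>"
proof -
  have "\<bar>ramp_slope K \<delta> r - ramp_slope K \<delta> s\<bar>
      = K / \<delta> * \<bar>(max 0 r - max 0 (r - \<delta>)) - (max 0 s - max 0 (s - \<delta>))\<bar>"
    unfolding ramp_slope_def right_diff_distrib[symmetric] abs_mult using assms by simp
  also have "\<dots> \<le> K / \<delta> * \<bar>r - s\<bar>"
    using assms by (intro mult_left_mono) auto
  finally show ?thesis .
qed

lemma ramp_nonneg: "0 \<le> K \<Longrightarrow> 0 < \<delta> \<Longrightarrow> 0 \<le> ramp K \<delta> r"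
  unfolding ramp_def hinge2_def
  by (intro mult_nonneg_nonneg) (auto intro!: power_mono)

text \<open>From \<open>\<delta>\<close> on, value and slope are both linear in \<open>K\<close>,
  which prepares the limit of large \<open>K\<close>; the value 0 on the left makes every
  nonpositive point a minimizer when \<open>K\<close> is nonnegative.\<close>

lemma ramp_eqs:
  assumes "0 < \<delta>"
  shows "r \<le> 0 \<Longrightarrow> ramp K \<delta> r = 0" "\<delta> \<le> r \<Longrightarrow> ramp K \<delta> r = K * (r - \<delta> / 2)"
    "\<delta> \<le> r \<Longrightarrow> ramp_slope K \<delta> r = K"
  using assms
  by (auto simp: ramp_def ramp_slope_def hinge2_def max_def field_simps power2_eq_square)

section \<open>Gradient inequality and the derivative of the Lyapunov function\<close>

text \<open>Restriction to the line through \<open>x\<close> and \<open>y\<close> reduces this to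
  the tangent inequality for convex functions of a real variable.\<close>

lemma F0inf_gradient_ineq:
  assumes f: "f \<in> F0inf d" and x: "x \<in> Rd d" and y: "y \<in> Rd d"
  shows "f x + inner (grad d f x) (y - x) \<le> f y"
proof -
  define h where "h = (\<lambda>s::real. f (x + s *\<^sub>R (y - x)))"
  have mem: "x + s *\<^sub>R (y - x) \<in> Rd d" for s
    using x y by (auto simp: Rd_def plus_fvec.rep_eq scaleR_fvec.rep_eq minus_fvec.rep_eq)
  have "convex_on UNIV h"
  proof (rule convex_onI)
    fix t u v :: real assume t: "0 < t" "t < 1"
    have "x + ((1 - t) *\<^sub>R u + t *\<^sub>R v) *\<^sub>R (y - x)
        = (1 - t) *\<^sub>R (x + u *\<^sub>R (y - x)) + t *\<^sub>R (x + v *\<^sub>R (y - x))"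
      by (simp add: algebra_simps)
    then show "h ((1 - t) *\<^sub>R u + t *\<^sub>R v) \<le> (1 - t) * h u + t * h v"
      using convex_onD[of "Rd d" f t "x + u *\<^sub>R (y - x)" "x + v *\<^sub>R (y - x)"] f mem t
      by (simp add: h_def F0inf_def)
  qed simp
  moreover have "(h has_real_derivative inner (grad d f x) (y - x)) (at 0)"
  proof -
    have p: "((\<lambda>s::real. x + s *\<^sub>R (y - x)) has_derivative (\<lambda>s. s *\<^sub>R (y - x))) (at 0)"
      by (auto intro!: derivative_eq_intros)
    have "(f has_derivative inner (grad d f x)) (at x within range (\<lambda>s. x + s *\<^sub>R (y - x)))"
      using is_gradient_grad[OF f x] mem
      by (auto simp: is_gradient_def intro: has_derivative_subset)
    then show ?thesis
      using has_derivative_in_compose[OF p, of f "inner (grad d f x)"]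
      by (simp add: h_def has_field_derivative_def mult_commute_abs)
  qed
  ultimately have "inner (grad d f x) (y - x) * (1 - 0) \<le> h 1 - h 0"
    by (intro convex_on_imp_above_tangent[where A = UNIV]) auto
  then show ?thesis by (simp add: h_def)
qed

text \<open>Each coordinate of \<open>X\<close> with index at least \<open>d\<close> is constantly 0
  on the positive half-line, hence has derivative 0 there.\<close>

lemma velocity_in_Rd:
  assumes X: "agf_trajectory d f X" and t: "t > 0"
  shows "velocity X t \<in> Rd d"
proof -
  have dX: "(X has_vector_derivative velocity X t) (at t)"
    using assms by (simp add: agf_trajectory_def velocity_def vector_derivative_works)
  have "coord (velocity X t) i = 0" if "i \<ge> d" for i
  proof -
    define e where "e = fvec_of (\<lambda>j. if j = i then 1 else 0)"
    have e: "coord e j = (if j = i then 1 else 0)" for j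
      unfolding e_def by (subst fvec_of_inverse) auto
    have ei: "inner e y = coord y i" for y
      by (subst inner_Rd[of _ "Suc i"]) (auto simp: Rd_def e)
    have "((\<lambda>s. inner e (X s)) has_vector_derivative inner e (velocity X t)) (at t)"
      by (rule bounded_linear.has_vector_derivative[OF bounded_linear_inner_right dX])
    moreover have "((\<lambda>s. inner e (X s)) has_vector_derivative 0) (at t)"
      by (rule has_vector_derivative_transform_within_open
          [OF has_vector_derivative_const, where S = "{0<..}"])
        (use X t that in \<open>auto simp: ei agf_trajectory_def Rd_def\<close>)
    ultimately show ?thesis using vector_derivative_unique_at ei by metis
  qed
  then show ?thesis by (simp add: Rd_def)
qed

text \<open>The flow equation eliminates the acceleration, leaving only \<open>x\<close>,
  \<open>v\<close> and \<open>g\<close>; its damping part ends up in the coefficients of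
  \<open>inner x v\<close> and \<open>inner v v\<close>.\<close>

lemma lyapunov_has_derivative:
  assumes f: "f \<in> F0inf d" and xs: "xs \<in> Rd d" and X: "agf_trajectory d f X" and t: "t > 0"
    and a: "(a has_real_derivative a') (at t)"
    and p11: "(p11 has_real_derivative p11') (at t)"
    and p12: "(p12 has_real_derivative p12') (at t)"
    and p22: "(p22 has_real_derivative p22') (at t)"
  defines "x \<equiv> X t - xs" and "v \<equiv> velocity X t" and "g \<equiv> grad d f (X t)"
  shows "(lyapunov d a (\<lambda>s. P_mat (p11 s) (p12 s) (p22 s)) f xs X has_real_derivative
     a' * (f (X t) - f xs) + (a t - 2 * p22 t) * inner v g - 2 * p12 t * inner x g
     + p11' * inner x x + 2 * (p11 t - 3 / t * p12 t + p12') * inner x v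
     + (2 * (p12 t - 3 / t * p22 t) + p22') * inner v v) (at t)"
proof -
  have XR: "X s \<in> Rd d" if "s > 0" for s
    using X that by (simp add: agf_trajectory_def)
  have dX: "(X has_vector_derivative v) (at t)"
    using X t by (simp add: agf_trajectory_def velocity_def v_def vector_derivative_works)
  have "(velocity X has_vector_derivative vector_derivative (velocity X) (at t)) (at t)"
    using X t by (simp add: agf_trajectory_def vector_derivative_works)
  moreover have "vector_derivative (velocity X) (at t) = - (3 / t) *\<^sub>R v - g"
  proof -
    have "vector_derivative (velocity X) (at t) + (3 / t) *\<^sub>R v + g = 0"
      using X t unfolding agf_trajectory_def v_def g_def by blast
    then show ?thesis by (simp add: algebra_simps eq_neg_iff_add_eq_0)
  qed
  ultimately have dv: "(velocity X has_vector_derivative - (3 / t) *\<^sub>R v - g) (at t)" by simp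
  have dx: "((\<lambda>s. X s - xs) has_vector_derivative v) (at t)"
    using dX by (auto intro!: derivative_eq_intros)
  have inner_deriv: "((\<lambda>s. inner (u s) (w s)) has_real_derivative inner u' (w t) + inner (u t) w') (at t)"
    if "(u has_vector_derivative u') (at t)" "(w has_vector_derivative w') (at t)"
    for u w :: "real \<Rightarrow> fvec" and u' w'
    unfolding has_field_derivative_def
    by (rule has_derivative_eq_rhs[OF has_derivative_inner[OF that[unfolded has_vector_derivative_def]]])
      (auto simp: algebra_simps)
  \<comment> \<open>As \<open>f\<close> is differentiable only within \<open>Rd d\<close>, the chain
    rule is applied within the image of the positive half-line, which \<open>X\<close> maps into
    \<open>Rd d\<close>.\<close>
  have df: "((\<lambda>s. f (X s)) has_real_derivative inner v g) (at t)"
  proof -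
    have p: "(X has_derivative (\<lambda>s. s *\<^sub>R v)) (at t within {0<..})"
      using dX unfolding has_vector_derivative_def by (rule has_derivative_at_withinI)
    have "(f has_derivative inner g) (at (X t) within X ` {0<..})"
      using is_gradient_grad[OF f XR[OF t]] XR
      by (auto simp: is_gradient_def g_def intro: has_derivative_subset)
    from has_derivative_in_compose[OF p this] t show ?thesis
      by (simp add: has_field_derivative_def at_within_open[of t "{0<..}"]
          inner_commute mult_commute_abs)
  qed
  have "((\<lambda>s. a s * (f (X s) - f xs)
      + (p11 s * inner (X s - xs) (X s - xs) + 2 * p12 s * inner (X s - xs) (velocity X s)
        + p22 s * inner (velocity X s) (velocity X s))) has_real_derivative
      (a' * (f (X t) - f xs) + a t * inner v g)
      + ((p11' * inner x x + p11 t * (inner v x + inner x v))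
        + (2 * p12' * inner x v + 2 * p12 t * (inner v v + inner x (- (3 / t) *\<^sub>R v - g)))
        + (p22' * inner v v + p22 t * (inner (- (3 / t) *\<^sub>R v - g) v + inner v (- (3 / t) *\<^sub>R v - g)))))
      (at t)"
    unfolding x_def
    by (auto intro!: derivative_eq_intros a p11 p12 p22 df inner_deriv[OF dx dx]
        inner_deriv[OF dx dv] inner_deriv[OF dv dv] simp: v_def[symmetric])
  also have "(a' * (f (X t) - f xs) + a t * inner v g)
      + ((p11' * inner x x + p11 t * (inner v x + inner x v))
        + (2 * p12' * inner x v + 2 * p12 t * (inner v v + inner x (- (3 / t) *\<^sub>R v - g)))
        + (p22' * inner v v + p22 t * (inner (- (3 / t) *\<^sub>R v - g) v + inner v (- (3 / t) *\<^sub>R v - g))))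
      = a' * (f (X t) - f xs) + (a t - 2 * p22 t) * inner v g - 2 * p12 t * inner x g
     + p11' * inner x x + 2 * (p11 t - 3 / t * p12 t + p12') * inner x v
     + (2 * (p12 t - 3 / t * p22 t) + p22') * inner v v"
    by (simp add: inner_diff_left inner_diff_right inner_commute[of v x] inner_commute[of g v]
        algebra_simps)
  finally show ?thesis
  proof (rule has_field_derivative_transform_within_open[where S = "{0<..}"])
    fix s :: real assume "s \<in> {0<..}"
    then have "X s - xs \<in> Rd d" "velocity X s \<in> Rd d"
      using XR[of s] xs velocity_in_Rd[OF X] by (auto simp: Rd_def minus_fvec.rep_eq)
    then show "a s * (f (X s) - f xs)
      + (p11 s * inner (X s - xs) (X s - xs) + 2 * p12 s * inner (X s - xs) (velocity X s)
        + p22 s * inner (velocity X s) (velocity X s))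
      = lyapunov d a (\<lambda>s. P_mat (p11 s) (p12 s) (p22 s)) f xs X s"
      by (simp add: lyapunov_def quad_form_kronecker_id)
  qed (use t in auto)
qed

section \<open>Limits of affine inequalities and the meaning of the matrix inequality\<close>

lemma nonpos_if_affine_nonpos_at_top:
  fixes \<alpha> \<beta> :: real
  assumes "\<And>K. K \<ge> 0 \<Longrightarrow> \<alpha> * K + \<beta> \<le> 0"
  shows "\<alpha> \<le> 0"
proof (rule ccontr)
  assume "\<not> \<alpha> \<le> 0"
  moreover from this have "\<alpha> * ((\<bar>\<beta>\<bar> + 1) / \<alpha>) + \<beta> > 0" by simp
  ultimately show False using assms[of "(\<bar>\<beta>\<bar> + 1) / \<alpha>"] by simp
qed

text \<open>Substituting \<open>\<delta> = 1 / (K + 2)\<close> turns the limit at 0 into one at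
  infinity; the summand 2 keeps \<open>\<delta>\<close> below 1 even for
  \<open>K = 0\<close>.\<close>

lemma nonpos_if_affine_nonpos_at_right_0:
  fixes \<alpha> \<beta> :: real
  assumes "\<And>\<delta>. 0 < \<delta> \<Longrightarrow> \<delta> < 1 \<Longrightarrow> \<alpha> + \<beta> * \<delta> \<le> 0"
  shows "\<alpha> \<le> 0"
proof (rule nonpos_if_affine_nonpos_at_top)
  fix K :: real assume "K \<ge> 0"
  then show "\<alpha> * K + (2 * \<alpha> + \<beta>) \<le> 0"
    using assms[of "1 / (K + 2)"] by (simp add: field_simps)
qed

text \<open>Because of the zero corner the form is affine in the third variable, so boundedness from
  above forces both coefficients of that variable to vanish.\<close>

lemma nsd_lmi_mat_iff:
  "nsd (lmi_mat t a p11 p12 p22 p11' p12' p22' l1) \<longleftrightarrow>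
     l1 = 2 * p12 \<and> a = 2 * p22 \<and>
     (\<forall>x v. p11' * x\<^sup>2 + 2 * (p11 - 3 / t * p12 + p12') * (x * v)
        + (2 * (p12 - 3 / t * p22) + p22') * v\<^sup>2 \<le> 0)"
    (is "?L \<longleftrightarrow> _ \<and> _ \<and> (\<forall>x v. ?Q x v \<le> 0)")
proof -
  define M where "M = lmi_mat t a p11 p12 p22 p11' p12' p22' l1"
  have sym: "transpose M = M"
    by (simp add: M_def lmi_mat_def vec_eq_iff transpose_def forall_3)
  have form: "inner y (M *v y) = ?Q (y$1) (y$2) + (l1 - 2 * p12) * (y$1 * y$3)
      + (a - 2 * p22) * (y$2 * y$3)" for y
    by (simp add: M_def lmi_mat_def inner_vec_def matrix_vector_mult_def sum_3)
      (simp add: algebra_simps power2_eq_square)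
  have L: "?L \<longleftrightarrow> (\<forall>y. inner y (M *v y) \<le> 0)"
    by (simp add: nsd_def sym flip: M_def)
  also have "\<dots> \<longleftrightarrow> (\<forall>x v g. ?Q x v + (l1 - 2 * p12) * (x * g) + (a - 2 * p22) * (v * g) \<le> 0)"
  proof safe
    fix x v g :: real assume "\<forall>y. inner y (M *v y) \<le> 0"
    from this[rule_format, of "vector [x, v, g]"]
    show "?Q x v + (l1 - 2 * p12) * (x * g) + (a - 2 * p22) * (v * g) \<le> 0"
      by (simp add: form)
  qed (simp only: form)
  also have "\<dots> \<longleftrightarrow> l1 = 2 * p12 \<and> a = 2 * p22 \<and> (\<forall>x v. ?Q x v \<le> 0)"
  proof
    assume H: "\<forall>x v g. ?Q x v + (l1 - 2 * p12) * (x * g) + (a - 2 * p22) * (v * g) \<le> 0"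
    \<comment> \<open>The third variable is \<open>s * K\<close> with \<open>K\<close> large; the
      two signs of \<open>s\<close> together give equality.\<close>
    have "s * (l1 - 2 * p12) \<le> 0" for s
      by (rule nonpos_if_affine_nonpos_at_top[of _ "?Q 1 0"])
        (use H[rule_format, of 1 0 "s * K" for K] in \<open>simp add: algebra_simps\<close>)
    from this[of 1] this[of "-1"] have l1: "l1 = 2 * p12" by simp
    have "s * (a - 2 * p22) \<le> 0" for s
      by (rule nonpos_if_affine_nonpos_at_top[of _ "?Q 0 1"])
        (use H[rule_format, of 0 1 "s * K" for K] in \<open>simp add: algebra_simps\<close>)
    from this[of 1] this[of "-1"] have "a = 2 * p22" by simp
    moreover have "?Q x v \<le> 0" for x v using H[rule_format, of x v 0] by simp
    ultimately show "l1 = 2 * p12 \<and> a = 2 * p22 \<and> (\<forall>x v. ?Q x v \<le> 0)" using l1 by blast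
  qed simp
  finally show ?thesis .
qed

section \<open>Equivalence of decrease and matrix inequality through scalar conditions at each
  time\<close>

theorem theorem2p7:
  fixes a p11 p12 p22 :: "real \<Rightarrow> real"
  assumes a_nonneg: "\<And>t. t > 0 \<Longrightarrow> a t \<ge> 0"
    and P_psd: "\<And>t. t > 0 \<Longrightarrow> psd (P_mat (p11 t) (p12 t) (p22 t))"
    and a_C1: "a C1_differentiable_on {0<..}"
    and p11_C1: "p11 C1_differentiable_on {0<..}"
    and p12_C1: "p12 C1_differentiable_on {0<..}"
    and p22_C1: "p22 C1_differentiable_on {0<..}"
  shows
    "(\<forall>d::nat. \<forall>f\<in>F0inf d. \<forall>xs X.
        is_arg_min f (\<lambda>x. x \<in> Rd d) xs \<longrightarrow> agf_trajectory d f X \<longrightarrow>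
        (\<forall>t>0. \<exists>D. (lyapunov d a (\<lambda>s. P_mat (p11 s) (p12 s) (p22 s)) f xs X
                     has_real_derivative D) (at t) \<and> D \<le> 0))
     \<longleftrightarrow>
     (\<forall>t>0. \<exists>l1 l2. l1 \<ge> 0 \<and> l2 \<ge> 0 \<and>
        nsd (lmi_mat t (a t) (p11 t) (p12 t) (p22 t)
               (deriv p11 t) (deriv p12 t) (deriv p22 t) l1) \<and>
        deriv a t = l1 - l2)"
proof -
  have deriv: "(h has_real_derivative deriv h t) (at t)"
    if "h C1_differentiable_on {0<..}" "t > 0" for h :: "real \<Rightarrow> real" and t
    using that
    by (auto simp: C1_differentiable_on_eq DERIV_deriv_iff_real_differentiable)
  note derivs = deriv[OF a_C1] deriv[OF p11_C1] deriv[OF p12_C1] deriv[OF p22_C1]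
  let ?P = "\<lambda>s. P_mat (p11 s) (p12 s) (p22 s)"
  define B where "B = (\<lambda>t. p11 t - 3 / t * p12 t + deriv p12 t)"
  define C where "C = (\<lambda>t. 2 * (p12 t - 3 / t * p22 t) + deriv p22 t)"
  \<comment> \<open>The intermediate condition is the matrix inequality with both multipliers
    eliminated.\<close>
  have "(\<forall>d::nat. \<forall>f\<in>F0inf d. \<forall>xs X.
        is_arg_min f (\<lambda>x. x \<in> Rd d) xs \<longrightarrow> agf_trajectory d f X \<longrightarrow>
        (\<forall>t>0. \<exists>D. (lyapunov d a ?P f xs X has_real_derivative D) (at t) \<and> D \<le> 0))
     \<longleftrightarrow>
     (\<forall>t>0. a t = 2 * p22 t \<and> 0 \<le> p12 t \<and> deriv a t \<le> 2 * p12 t \<and>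
        (\<forall>x v. deriv p11 t * x\<^sup>2 + 2 * B t * (x * v) + C t * v\<^sup>2 \<le> 0))"
    (is "?decr \<longleftrightarrow> ?cond")
  proof
    assume decr: ?decr
    show ?cond
    proof (intro allI impI)
      fix t :: real assume t: "t > 0"
      \<comment> \<open>Decrease at time \<open>t\<close> for \<open>ramp K \<delta>\<close>,
        position \<open>y\<close>, velocity \<open>u\<close> and minimizer \<open>-R\<close>. The
        offset \<open>R\<close> is free since the ramp attains its minimum 0 at every nonpositive
        point.\<close>
      have key: "deriv a t * ramp K \<delta> y + (a t - 2 * p22 t) * (u * ramp_slope K \<delta> y)
          - 2 * p12 t * ((y + R) * ramp_slope K \<delta> y)
          + deriv p11 t * (y + R)\<^sup>2 + 2 * B t * ((y + R) * u) + C t * u\<^sup>2 \<le> 0"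
        if K: "0 \<le> K" and \<delta>: "0 < \<delta>" and R: "0 \<le> R" for K \<delta> R y u
      proof -
        define f where "f = (\<lambda>z. ramp K \<delta> (inner e0 z))"
        note ramp = has_real_derivative_ramp mono_ramp_slope[OF K \<delta>]
        obtain x v where x: "x t = y" "v t = u"
          "\<And>s. s > 0 \<Longrightarrow> (x has_real_derivative v s) (at s)"
          "\<And>s. s > 0 \<Longrightarrow> (v has_real_derivative - (3 / s) * v s - ramp_slope K \<delta> (x s)) (at s)"
          using scalar_agf_solution_exists[OF ramp_slope_lipschitz[OF K \<delta>] t] by metis
        let ?X = "\<lambda>s. x s *\<^sub>R e0" and ?xs = "(- R) *\<^sub>R e0"
        have f: "f \<in> F0inf 1" unfolding f_def by (rule line_function_F0inf[OF ramp])
        have X: "agf_trajectory 1 f ?X" and vel: "velocity ?X t = u *\<^sub>R e0"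
          using line_trajectory[OF ramp x(3,4)] t x(2) by (simp_all add: f_def)
        have grad: "grad 1 f (?X t) = ramp_slope K \<delta> y *\<^sub>R e0"
          unfolding f_def using line_function_grad[OF ramp scaleR_e0_in_Rd, of "x t"] x(1) by simp
        have fxs: "f ?xs = 0"
          using ramp_eqs(1)[OF \<delta>] R unfolding f_def inner_e0 coord_scaleR_e0 by simp
        have fX: "f (?X t) = ramp K \<delta> y" by (simp add: f_def x(1))
        have "is_arg_min f (\<lambda>x. x \<in> Rd 1) ?xs"
          unfolding is_arg_min_def fxs
        proof (intro conjI scaleR_e0_in_Rd)
          show "\<not> (\<exists>z. z \<in> Rd 1 \<and> f z < 0)"
            using ramp_nonneg[OF K \<delta>] by (auto simp: f_def not_less)
        qed
        then obtain D where D: "(lyapunov 1 a ?P f ?xs ?X has_real_derivative D) (at t)" "D \<le> 0"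
          using decr f X t by blast
        have diff: "?X t - ?xs = (y + R) *\<^sub>R e0"
          by (simp add: x(1) scaleR_add_left)
        have "D = deriv a t * (f (?X t) - f ?xs)
            + (a t - 2 * p22 t) * inner (velocity ?X t) (grad 1 f (?X t))
            - 2 * p12 t * inner (?X t - ?xs) (grad 1 f (?X t))
            + deriv p11 t * inner (?X t - ?xs) (?X t - ?xs)
            + 2 * (p11 t - 3 / t * p12 t + deriv p12 t) * inner (?X t - ?xs) (velocity ?X t)
            + (2 * (p12 t - 3 / t * p22 t) + deriv p22 t) * inner (velocity ?X t) (velocity ?X t)"
          by (rule DERIV_unique[OF D(1) lyapunov_has_derivative[OF f scaleR_e0_in_Rd X t derivs]])
            (rule t)+
        then show ?thesis
          using D(2) unfolding diff vel grad fxs fX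
          by (simp add: B_def C_def power2_eq_square algebra_simps)
      qed
      \<comment> \<open>For \<open>K = 0\<close> the function vanishes and only the quadratic form
        remains.\<close>
      have form: "deriv p11 t * x\<^sup>2 + 2 * B t * (x * u) + C t * u\<^sup>2 \<le> 0" for x u
        using key[of 0 1 0 x u] by (simp add: ramp_def ramp_slope_def)
      \<comment> \<open>Position \<open>\<delta>\<close>, velocity \<open>s\<close>, minimizer 0:
        the gap is \<open>K * \<delta> / 2\<close> and \<open>inner x g\<close> is
        \<open>K * \<delta>\<close>, so both disappear with \<open>\<delta>\<close> after division
        by \<open>K\<close>.\<close>
      have "s * (a t - 2 * p22 t) \<le> 0" for s
      proof (rule nonpos_if_affine_nonpos_at_right_0)
        fix \<delta> :: real assume \<delta>: "0 < \<delta>" "\<delta> < 1"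
        show "s * (a t - 2 * p22 t) + (deriv a t / 2 - 2 * p12 t) * \<delta> \<le> 0"
        proof (rule nonpos_if_affine_nonpos_at_top)
          fix K :: real assume "K \<ge> 0"
          then show "(s * (a t - 2 * p22 t) + (deriv a t / 2 - 2 * p12 t) * \<delta>) * K
              + (deriv p11 t * \<delta>\<^sup>2 + 2 * B t * (\<delta> * s) + C t * s\<^sup>2) \<le> 0"
            using key[of K \<delta> 0 \<delta> s] \<delta> by (simp add: ramp_eqs algebra_simps)
        qed
      qed
      from this[of 1] this[of "-1"] have "a t = 2 * p22 t" by simp
      \<comment> \<open>At rest at position 1 with minimizer 0: the gap is
        \<open>K * (1 - \<delta> / 2)\<close> against \<open>inner x g = K\<close>. The bound
        \<open>\<delta> < 1\<close> places position 1 on the part of full slope.\<close>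
      moreover have "deriv a t - 2 * p12 t \<le> 0"
      proof (rule nonpos_if_affine_nonpos_at_right_0)
        fix \<delta> :: real assume \<delta>: "0 < \<delta>" "\<delta> < 1"
        show "deriv a t - 2 * p12 t + (- deriv a t / 2) * \<delta> \<le> 0"
        proof (rule nonpos_if_affine_nonpos_at_top)
          fix K :: real assume "K \<ge> 0"
          then show "(deriv a t - 2 * p12 t + (- deriv a t / 2) * \<delta>) * K + deriv p11 t \<le> 0"
            using key[of K \<delta> 0 1 0] \<delta> by (simp add: ramp_eqs algebra_simps)
        qed
      qed
      \<comment> \<open>At rest at position \<open>\<delta>\<close> with minimizer -1: the gap
        \<open>K * \<delta> / 2\<close> is negligible against
        \<open>inner x g = K * (\<delta> + 1)\<close>.\<close>
      moreover have "- 2 * p12 t \<le> 0"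
      proof (rule nonpos_if_affine_nonpos_at_right_0)
        fix \<delta> :: real assume \<delta>: "0 < \<delta>" "\<delta> < 1"
        show "- 2 * p12 t + (deriv a t / 2 - 2 * p12 t) * \<delta> \<le> 0"
        proof (rule nonpos_if_affine_nonpos_at_top)
          fix K :: real assume "K \<ge> 0"
          then show "(- 2 * p12 t + (deriv a t / 2 - 2 * p12 t) * \<delta>) * K
              + deriv p11 t * (\<delta> + 1)\<^sup>2 \<le> 0"
            using key[of K \<delta> 1 \<delta> 0] \<delta> by (simp add: ramp_eqs algebra_simps)
        qed
      qed
      ultimately show "a t = 2 * p22 t \<and> 0 \<le> p12 t \<and> deriv a t \<le> 2 * p12 t \<and>
        (\<forall>x v. deriv p11 t * x\<^sup>2 + 2 * B t * (x * v) + C t * v\<^sup>2 \<le> 0)"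
        using form by simp
    qed
  next
    assume cond: ?cond
    show ?decr
    proof (intro allI ballI impI)
      fix d f xs X and t :: real
      assume f: "f \<in> F0inf d" and min: "is_arg_min f (\<lambda>x. x \<in> Rd d) xs"
        and X: "agf_trajectory d f X" and t: "t > 0"
      define x where "x = X t - xs"
      define v where "v = velocity X t"
      define g where "g = grad d f (X t)"
      have a: "a t = 2 * p22 t" and p12: "0 \<le> p12 t" and a': "deriv a t \<le> 2 * p12 t"
        and form: "deriv p11 t * y\<^sup>2 + 2 * B t * (y * u) + C t * u\<^sup>2 \<le> 0" for y u
        using cond t by auto
      have xs: "xs \<in> Rd d" using min by (simp add: is_arg_min_def)
      have XR: "X t \<in> Rd d" using X t by (simp add: agf_trajectory_def)
      have x: "x \<in> Rd d" using XR xs by (auto simp: x_def Rd_def minus_fvec.rep_eq)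
      have v: "v \<in> Rd d" unfolding v_def by (rule velocity_in_Rd[OF X t])
      have gap: "0 \<le> f (X t) - f xs" using min XR by (auto simp: is_arg_min_def not_less)
      have tangent: "f (X t) - f xs \<le> inner x g"
        using F0inf_gradient_ineq[OF f XR xs]
        by (simp add: x_def g_def inner_diff_left inner_diff_right inner_commute)
      \<comment> \<open>The form splits over the coordinates, so its sign in two real variables
        carries over to every dimension.\<close>
      have "deriv p11 t * inner x x + 2 * B t * inner x v + C t * inner v v
          = (\<Sum>i<d. deriv p11 t * (coord x i)\<^sup>2 + 2 * B t * (coord x i * coord v i) + C t * (coord v i)\<^sup>2)"
        by (simp add: inner_Rd[OF x] inner_Rd[OF v] sum.distrib sum_distrib_left power2_eq_square)
      also have "\<dots> \<le> 0" by (intro sum_nonpos form)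
      finally have quad: "deriv p11 t * inner x x + 2 * B t * inner x v + C t * inner v v \<le> 0" .
      \<comment> \<open>Two steps through \<open>2 * p12 t\<close> times the gap: the first uses
        that the gap is nonnegative, the second the sign of \<open>p12 t\<close>.\<close>
      have "deriv a t * (f (X t) - f xs) \<le> 2 * p12 t * inner x g"
        using mult_right_mono[OF a' gap] mult_left_mono[OF tangent, of "2 * p12 t"] p12 by simp
      then show "\<exists>D. (lyapunov d a ?P f xs X has_real_derivative D) (at t) \<and> D \<le> 0"
        using lyapunov_has_derivative[OF f xs X t derivs[OF t]] quad a
        by (intro exI conjI) (assumption, simp add: B_def C_def x_def v_def g_def)
    qed
  qed
  also have "\<dots> \<longleftrightarrow> (\<forall>t>0. \<exists>l1 l2. l1 \<ge> 0 \<and> l2 \<ge> 0 \<and>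
        nsd (lmi_mat t (a t) (p11 t) (p12 t) (p22 t)
               (deriv p11 t) (deriv p12 t) (deriv p22 t) l1) \<and>
        deriv a t = l1 - l2)"
  proof -
    have "(\<exists>l1 l2. l1 \<ge> 0 \<and> l2 \<ge> 0 \<and> (l1 = 2 * p \<and> A \<and> Q) \<and> a' = l1 - l2)
        \<longleftrightarrow> A \<and> 0 \<le> p \<and> a' \<le> 2 * p \<and> Q" for p a' :: real and A Q
    proof
      assume "A \<and> 0 \<le> p \<and> a' \<le> 2 * p \<and> Q"
      then show "\<exists>l1 l2. l1 \<ge> 0 \<and> l2 \<ge> 0 \<and> (l1 = 2 * p \<and> A \<and> Q) \<and> a' = l1 - l2"
        \<comment> \<open>The first multiplier is forced; the second is the slack in the bound on
          the derivative of \<open>a\<close>.\<close>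
        by (intro exI[of _ "2 * p"] exI[of _ "2 * p - a'"]) simp
    qed auto
    then show ?thesis unfolding nsd_lmi_mat_iff B_def C_def by simp
  qed
  finally show ?thesis .
qed

end
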